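(* Let $G$ be the disjointness graph of a finite family of $x$-monotone curves in the plane with $\omega(G)=k$. Then $\chi(G)\leq k^{3}(k+1)/2$.
   Context: A curve is the image of a continuous map $\phi:[0,1]\to\mathbb{R}^2$; it is $x$-monotone if every vertical line meets it in at most one point. The disjointness graph of a family of curves has the curves as vertices, two being adjacent iff the curves are disjoint. $\omega$ and $\chi$ denote clique number and chromatic number. *)

theory Defs
  imports "HOL-Analysis.Analysis" "HOL-Library.Ramsey"
begin

definition is_curve :: "(real ^ 2) set \<Rightarrow> bool" where
  "is_curve S \<longleftrightarrow> (\<exists>\<phi>. path \<phi> \<and> S = path_image \<phi>)"

definition vertical_line :: "real \<Rightarrow> (real ^ 2) set" where
  "vertical_line a = {p. p $ 1 = a}"

definition x_monotone_curve :: "(real ^ 2) set \<Rightarrow> bool" where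
  "x_monotone_curve S \<longleftrightarrow>
     is_curve S \<and> (\<forall>a. \<forall>p \<in> S \<inter> vertical_line a. \<forall>q \<in> S \<inter> vertical_line a. p = q)"

text \<open>
  Graphs are given, as in \<^theory>\<open>HOL-Library.Ramsey\<close>, by a vertex set and a set of two-element
  subsets of it; \<^const>\<open>clique\<close> is taken from there.
  A family of sets is indexed, and its indices serve as vertices, so a set may occur repeatedly.
\<close>

definition disjointness_edges :: "'i set \<Rightarrow> ('i \<Rightarrow> 'p set) \<Rightarrow> 'i set set" where
  "disjointness_edges I C = {{i, j} | i j. i \<in> I \<and> j \<in> I \<and> i \<noteq> j \<and> C i \<inter> C j = {}}"

text \<open>Both of the following numbers are meaningful only for finite vertex sets.\<close>

definition clique_number :: "'v set \<Rightarrow> 'v set set \<Rightarrow> nat" where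
  "clique_number V E = Max {card R | R. R \<subseteq> V \<and> clique R E}"

definition proper_colouring :: "'v set \<Rightarrow> 'v set set \<Rightarrow> ('v \<Rightarrow> nat) \<Rightarrow> bool" where
  "proper_colouring V E c \<longleftrightarrow> (\<forall>u\<in>V. \<forall>v\<in>V. {u, v} \<in> E \<longrightarrow> c u \<noteq> c v)"

definition chromatic_number :: "'v set \<Rightarrow> 'v set set \<Rightarrow> nat" where
  "chromatic_number V E = (LEAST m. \<exists>c. c ` V \<subseteq> {..<m} \<and> proper_colouring V E c)"

end

theory Submission
  imports Defs
begin

text \<open>
  A pair of disjoint curves is comparable in one of four partial orders: their projections to the
  horizontal axis are nested or not, and above the common part of the projections one curve lies
  below the other. Colouring every curve with its four heights uses at most \<open>k ^ 4\<close> colours. The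
  saving comes from the two orders for nested projections: the curves under \<open>v\<close> in the one order
  lie below \<open>v\<close>, those under \<open>v\<close> in the other lie above it, and \<open>v\<close> separates them. Hence the two
  heights \<open>p\<close>, \<open>q\<close> of \<open>v\<close> satisfy \<open>p + q - 1 \<le> k\<close>, which leaves only \<open>k * (k + 1) / 2\<close> pairs.
\<close>

subsection \<open>Heights and colourings\<close>

lemma card_clique_le_clique_number:
  assumes "finite V" "X \<subseteq> V" "clique X E"
  shows "card X \<le> clique_number V E"
proof -
  have "{card R | R. R \<subseteq> V \<and> clique R E} \<subseteq> card ` Pow V" by auto
  then have "finite {card R | R. R \<subseteq> V \<and> clique R E}"
    using assms(1) finite_subset by blast
  then show ?thesis
    unfolding clique_number_def using assms by (intro Max_ge) auto
qed

text \<open>Colours may come from any finite set, so that tuples of heights can serve as colours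
  without being numbered by hand.\<close>

lemma chromatic_number_le_card:
  assumes "finite T" "c ` V \<subseteq> T"
    and "\<And>u v. u \<in> V \<Longrightarrow> v \<in> V \<Longrightarrow> {u, v} \<in> E \<Longrightarrow> c u \<noteq> c v"
  shows "chromatic_number V E \<le> card T"
proof -
  obtain g where g: "bij_betw g T {..<card T}"
    using assms(1) by (metis atLeast0LessThan ex_bij_betw_finite_nat)
  have "(g \<circ> c) ` V \<subseteq> {..<card T}"
    using g assms(2) by (auto simp: bij_betw_def)
  moreover have "proper_colouring V E (g \<circ> c)"
    unfolding proper_colouring_def
    using g assms(2,3) by (auto simp: bij_betw_def dest!: inj_onD)
  ultimately show ?thesis
    unfolding chromatic_number_def by (intro Least_le) blast
qed

text \<open>
  For a transitive relation contained in the edges, the cliques under \<open>v\<close> may replace the chains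
  with top element \<open>v\<close>.
\<close>

definition cliques_under :: "'v set \<Rightarrow> 'v set set \<Rightarrow> ('v \<Rightarrow> 'v \<Rightarrow> bool) \<Rightarrow> 'v \<Rightarrow> 'v set set" where
  "cliques_under V E R v = {X. X \<subseteq> V \<and> clique X E \<and> v \<in> X \<and> (\<forall>u\<in>X - {v}. R u v)}"

definition height :: "'v set \<Rightarrow> 'v set set \<Rightarrow> ('v \<Rightarrow> 'v \<Rightarrow> bool) \<Rightarrow> 'v \<Rightarrow> nat" where
  "height V E R v = Max (card ` cliques_under V E R v)"

lemma finite_cliques_under: "finite V \<Longrightarrow> finite (cliques_under V E R v)"
  by (rule finite_subset[of _ "Pow V"]) (auto simp: cliques_under_def)

lemma height_attained:
  assumes "finite V" "v \<in> V"
  obtains X where "X \<in> cliques_under V E R v" "card X = height V E R v"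
proof -
  have "{v} \<in> cliques_under V E R v"
    using assms(2) by (auto simp: cliques_under_def clique_def)
  then have "height V E R v \<in> card ` cliques_under V E R v"
    unfolding height_def using finite_cliques_under[OF assms(1)] by (intro Max_in) auto
  then show ?thesis using that by auto
qed

lemma card_le_height:
  assumes "finite V" "X \<in> cliques_under V E R v"
  shows "card X \<le> height V E R v"
  unfolding height_def using assms finite_cliques_under[OF assms(1)] by (intro Max_ge) auto

lemma height_bounds:
  assumes "finite V" "v \<in> V"
  shows "height V E R v \<in> {1..clique_number V E}"
proof -
  obtain X where X: "X \<in> cliques_under V E R v" "card X = height V E R v"
    using height_attained[OF assms] .
  have XV: "X \<subseteq> V" "clique X E" "v \<in> X"
    using X(1) by (auto simp: cliques_under_def)
  then have "card X > 0" using assms(1) by (metis card_gt_0_iff empty_iff finite_subset)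
  then show ?thesis
    using card_clique_le_clique_number[OF assms(1) XV(1,2)] X(2) by auto
qed

text \<open>A largest clique under \<open>u\<close> grows by \<open>v\<close>: transitivity puts all
  of it under \<open>v\<close>, and related vertices are adjacent. It cannot contain
  \<open>v\<close> already, since that would make \<open>v\<close> adjacent to itself.\<close>

lemma height_less:
  assumes "finite V" "u \<in> V" "v \<in> V" "R u v"
    and edge: "\<And>x y. x \<in> V \<Longrightarrow> y \<in> V \<Longrightarrow> R x y \<Longrightarrow> {x, y} \<in> E"
    and trans: "\<And>x y z. x \<in> V \<Longrightarrow> y \<in> V \<Longrightarrow> z \<in> V \<Longrightarrow> R x y \<Longrightarrow> R y z \<Longrightarrow> R x z"
    and loopless: "\<And>x. {x} \<notin> E"
  shows "height V E R u < height V E R v"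
proof -
  obtain X where X: "X \<in> cliques_under V E R u" "card X = height V E R u"
    using height_attained[OF assms(1,2)] .
  have XV: "X \<subseteq> V" "clique X E" and Xu: "\<And>x. x \<in> X \<Longrightarrow> x = u \<or> R x u"
    using X(1) by (auto simp: cliques_under_def)
  have Xv: "R x v" if "x \<in> X" for x
    using Xu[OF that] that XV(1) assms(2-4) trans by blast
  have Xe: "{x, v} \<in> E" if "x \<in> X" for x
    using Xv[OF that] that XV(1) assms(3) edge by blast
  have "v \<notin> X" using Xe[of v] loopless by auto
  moreover have "insert v X \<in> cliques_under V E R v"
    using XV Xv Xe assms(3) by (auto simp: cliques_under_def clique_def insert_commute)
  moreover have "finite X" using XV(1) assms(1) finite_subset by blast
  ultimately show ?thesis
    using card_le_height[OF assms(1)] X(2) by fastforce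
qed

text \<open>Glue a largest clique under \<open>v\<close> for \<open>R\<close> to one for
  \<open>R'\<close>. By \<open>cross\<close> the union is again a clique; the two share only
  \<open>v\<close>, which is therefore counted twice and accounts for the
  \<open>+ 1\<close>.\<close>

lemma height_add_le:
  assumes "finite V" "v \<in> V"
    and cross: "\<And>x y. x \<in> V \<Longrightarrow> y \<in> V \<Longrightarrow> R x v \<Longrightarrow> R' y v \<Longrightarrow> {x, y} \<in> E"
    and loopless: "\<And>x. {x} \<notin> E"
  shows "height V E R v + height V E R' v \<le> clique_number V E + 1"
proof -
  obtain X where X: "X \<in> cliques_under V E R v" "card X = height V E R v"
    using height_attained[OF assms(1,2)] .
  obtain Y where Y: "Y \<in> cliques_under V E R' v" "card Y = height V E R' v"
    using height_attained[OF assms(1,2)] .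
  have XV: "X \<subseteq> V" "clique X E" "v \<in> X" "\<And>x. x \<in> X \<Longrightarrow> x = v \<or> R x v"
    and YV: "Y \<subseteq> V" "clique Y E" "v \<in> Y" "\<And>y. y \<in> Y \<Longrightarrow> y = v \<or> R' y v"
    using X(1) Y(1) by (auto simp: cliques_under_def)
  have XY: "{x, y} \<in> E" if "x \<in> X" "y \<in> Y" "x \<noteq> y" for x y
  proof (cases "x = v \<or> y = v")
    case True
    then show ?thesis using that XV YV unfolding clique_def by blast
  next
    case False
    then show ?thesis using that XV YV cross by blast
  qed
  have fin: "finite X" "finite Y" using XV(1) YV(1) assms(1) finite_subset by blast+
  have "X \<inter> Y = {v}"
  proof -
    have "x = v" if "x \<in> X" "x \<in> Y" for x
    proof (rule ccontr)
      assume "x \<noteq> v"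
      \<comment> \<open>A second common vertex would satisfy both relations to \<open>v\<close>, so
        \<open>cross\<close> applied to it twice yields a loop.\<close>
      then have "{x, x} \<in> E" using that XV YV by (intro cross) blast+
      then show False using loopless by simp
    qed
    then show ?thesis using XV(3) YV(3) by blast
  qed
  then have "card X + card Y = card (X \<union> Y) + 1"
    using card_Un_Int[OF fin] by simp
  moreover have "{y, x} \<in> E" if "x \<in> X" "y \<in> Y" "y \<noteq> x" for x y
    using XY[of x y] that by (auto simp: insert_commute)
  then have "clique (X \<union> Y) E"
    using XV(2) YV(2) XY unfolding clique_def by blast
  then have "card (X \<union> Y) \<le> clique_number V E"
    using XV(1) YV(1) by (intro card_clique_le_clique_number assms(1)) auto
  ultimately show ?thesis using X(2) Y(2) by simp
qed

section \<open>Counting the colours for four orders\<close>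

lemma card_triangle:
  "2 * card (SIGMA p:{1..k}. {1..k + 1 - p}) = k * (k + 1)" for k :: nat
proof -
  have "card (SIGMA p:{1..k}. {1..k + 1 - p}) = (\<Sum>p=1..k. k + 1 - p)"
    by (subst card_SigmaI) auto
  also have "\<dots> = (\<Sum>p=1..k. p)"
    by (rule sum.reindex_bij_witness[of _ "\<lambda>p. k + 1 - p" "\<lambda>p. k + 1 - p"]) auto
  also have "2 * \<dots> = k * (k + 1)"
    by (induction k) auto
  finally show ?thesis .
qed

text \<open>This is the combinatorial core, free of geometry. Adjacent vertices are comparable in
  some order, so their quadruples of heights differ in that coordinate. Only orders 2 and 3 are tied
  together, by \<open>cross\<close>. The factor 2 avoids division of natural numbers.\<close>

proposition chromatic_number_le_four_orders:
  fixes R :: "nat \<Rightarrow> 'v \<Rightarrow> 'v \<Rightarrow> bool"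
  assumes fin: "finite V"
    and loopless: "\<And>x. {x} \<notin> E"
    and edge: "\<And>n x y. x \<in> V \<Longrightarrow> y \<in> V \<Longrightarrow> R n x y \<Longrightarrow> {x, y} \<in> E"
    and trans: "\<And>n x y z. x \<in> V \<Longrightarrow> y \<in> V \<Longrightarrow> z \<in> V \<Longrightarrow> R n x y \<Longrightarrow> R n y z \<Longrightarrow> R n x z"
    and comparable: "\<And>x y. x \<in> V \<Longrightarrow> y \<in> V \<Longrightarrow> {x, y} \<in> E \<Longrightarrow> \<exists>n<4. R n x y \<or> R n y x"
    and cross: "\<And>x y v. x \<in> V \<Longrightarrow> y \<in> V \<Longrightarrow> v \<in> V \<Longrightarrow> R 2 x v \<Longrightarrow> R 3 y v \<Longrightarrow> {x, y} \<in> E"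
  shows "2 * chromatic_number V E \<le> clique_number V E ^ 3 * (clique_number V E + 1)"
proof -
  define k where "k = clique_number V E"
  define h where "h n = height V E (R n)" for n
  \<comment> \<open>The first two heights range freely; the last two fill a triangle, because
    \<open>height_add_le\<close> bounds their sum by \<open>k + 1\<close>.\<close>
  define T where "T = {1..k} \<times> {1..k} \<times> (SIGMA p:{1..k}. {1..k + 1 - p})"
  have bounds: "h n v \<in> {1..k}" if "v \<in> V" for n v
    unfolding h_def k_def by (rule height_bounds[OF fin that])
  have less: "h n u < h n v" if "u \<in> V" "v \<in> V" "R n u v" for n u v
    unfolding h_def
    by (rule height_less[where R = "R n", OF fin that])
      (use edge trans loopless in blast)+
  have add: "h 2 v + h 3 v \<le> k + 1" if "v \<in> V" for v
    unfolding h_def k_def by (rule height_add_le[OF fin that cross loopless]) (use that in auto)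
  have "chromatic_number V E \<le> card T"
  proof (rule chromatic_number_le_card)
    show "finite T" unfolding T_def by auto
    show "(\<lambda>v. (h 0 v, h 1 v, h 2 v, h 3 v)) ` V \<subseteq> T"
    proof (clarify)
      fix v assume "v \<in> V"
      then show "(h 0 v, h 1 v, h 2 v, h 3 v) \<in> T"
        using bounds[of v] add[of v] bounds[of v 3] by (simp add: T_def)
    qed
    show "(h 0 u, h 1 u, h 2 u, h 3 u) \<noteq> (h 0 v, h 1 v, h 2 v, h 3 v)"
      if uv: "u \<in> V" "v \<in> V" "{u, v} \<in> E" for u v
    proof -
      obtain n where "n < 4" "R n u v \<or> R n v u"
        using comparable[OF uv] by blast
      then have "h n u \<noteq> h n v" using less uv by (metis less_irrefl)
      moreover have "n = 0 \<or> n = 1 \<or> n = 2 \<or> n = 3" using \<open>n < 4\<close> by auto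
      ultimately show ?thesis by auto
    qed
  qed
  moreover have "2 * card T = k ^ 3 * (k + 1)"
    using card_triangle[of k]
    by (simp add: T_def card_cartesian_product power3_eq_cube algebra_simps del: card_SigmaI)
  ultimately show ?thesis unfolding k_def by linarith
qed

subsection \<open>Monotone curves as graphs of functions\<close>

definition graph_over :: "real \<Rightarrow> real \<Rightarrow> (real \<Rightarrow> real) \<Rightarrow> (real ^ 2) set" where
  "graph_over a b f = {p. a \<le> p $ 1 \<and> p $ 1 \<le> b \<and> p $ 2 = f (p $ 1)}"

text \<open>The projection to the first axis is a continuous injection on the compact set
  \<open>S\<close>, hence has a continuous inverse on its image, a compact interval. The second
  coordinate of this inverse is the required function. A single point gives
  \<open>a = b\<close>.\<close>

lemma x_monotone_curve_graph:
  assumes "x_monotone_curve S"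
  obtains a b f where "a \<le> b" "continuous_on {a..b} f" "S = graph_over a b f"
proof -
  let ?p = "\<lambda>q::real^2. q $ 1"
  obtain \<phi> where \<phi>: "path \<phi>" "S = path_image \<phi>"
    using assms unfolding x_monotone_curve_def is_curve_def by blast
  have inj: "inj_on ?p S"
    using assms unfolding x_monotone_curve_def vertical_line_def inj_on_def by auto
  have cont: "continuous_on S ?p" by (intro continuous_intros)
  have comp: "compact S" using \<phi> by (simp add: compact_path_image)
  have "compact (?p ` S)" using cont comp compact_continuous_image by blast
  moreover have "connected (?p ` S)"
    using cont \<phi> connected_continuous_image connected_path_image by blast
  ultimately obtain a b where ab: "?p ` S = {a..b}"
    using connected_compact_interval_1 by (metis cbox_interval)
  let ?g = "inv_into S ?p"
  have ginv: "?g (q $ 1) = q" if "q \<in> S" for q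
    using inj that by (rule inv_into_f_f)
  have "continuous_on {a..b} ?g"
    using continuous_on_inv[OF cont comp, of ?g] ginv ab by auto
  then have "continuous_on {a..b} (\<lambda>x. ?g x $ 2)" by (intro continuous_intros)
  moreover have "{a..b} \<noteq> {}"
    using ab \<phi>(2) path_image_nonempty[of \<phi>] by (metis image_is_empty)
  then have "a \<le> b" by simp
  moreover have "S = graph_over a b (\<lambda>x. ?g x $ 2)"
  proof (intro equalityI subsetI)
    fix q assume "q \<in> S"
    moreover from this have "q $ 1 \<in> {a..b}" using ab by blast
    ultimately show "q \<in> graph_over a b (\<lambda>x. ?g x $ 2)"
      using ginv by (auto simp: graph_over_def)
  next
    fix q assume q: "q \<in> graph_over a b (\<lambda>x. ?g x $ 2)"
    then have "q $ 1 \<in> ?p ` S" using ab by (auto simp: graph_over_def)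
    then obtain r where r: "r \<in> S" "q $ 1 = r $ 1" by auto
    then have "q $ 2 = r $ 2" using q ginv[OF r(1)] by (auto simp: graph_over_def)
    then have "q = r" using r(2) by (auto simp: vec_eq_iff forall_2)
    then show "q \<in> S" using r(1) by simp
  qed
  ultimately show ?thesis using that by blast
qed

lemma graph_over_disjoint_iff:
  "graph_over a b f \<inter> graph_over c d g = {} \<longleftrightarrow> (\<forall>x\<in>{a..b} \<inter> {c..d}. f x \<noteq> g x)"
proof
  assume disj: "graph_over a b f \<inter> graph_over c d g = {}"
  show "\<forall>x\<in>{a..b} \<inter> {c..d}. f x \<noteq> g x"
  proof (intro ballI notI)
    fix x assume "x \<in> {a..b} \<inter> {c..d}" "f x = g x"
    then have "vector [x, f x] \<in> graph_over a b f \<inter> graph_over c d g"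
      by (auto simp: graph_over_def)
    then show False using disj by auto
  qed
qed (fastforce simp: graph_over_def simp del: Int_atLeastAtMost)

text \<open>Intermediate value theorem for \<open>f - g\<close>. An empty \<open>S\<close> is
  allowed and satisfies both alternatives.\<close>

lemma continuous_never_equal:
  fixes f g :: "real \<Rightarrow> real"
  assumes "continuous_on S f" "continuous_on S g" "connected S" "\<forall>x\<in>S. f x \<noteq> g x"
  shows "(\<forall>x\<in>S. f x < g x) \<or> (\<forall>x\<in>S. g x < f x)"
proof (rule ccontr)
  assume "\<not> ?thesis"
  then obtain x y where xy: "x \<in> S" "y \<in> S" "f x - g x \<ge> 0" "f y - g y \<le> 0"
    by (auto simp: not_less)
  have "connected ((\<lambda>x. f x - g x) ` S)"
    using assms by (intro connected_continuous_image continuous_intros)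
  then have "0 \<in> (\<lambda>x. f x - g x) ` S"
    using connectedD_interval[OF _ imageI[OF xy(2)] imageI[OF xy(1)]] xy(3,4) by blast
  then show False using assms(4) by auto
qed

section \<open>The four orders on a family of curves\<close>

theorem theorem6:
  fixes I :: "'i set" and C :: "'i \<Rightarrow> (real ^ 2) set" and k :: nat
  assumes "finite I"
    and "\<And>i. i \<in> I \<Longrightarrow> x_monotone_curve (C i)"
    and "clique_number I (disjointness_edges I C) = k"
  shows "real (chromatic_number I (disjointness_edges I C)) \<le> real k ^ 3 * (real k + 1) / 2"
proof -
  let ?E = "disjointness_edges I C"
  have "\<forall>i\<in>I. \<exists>a b f. a \<le> b \<and> continuous_on {a..b} f \<and> C i = graph_over a b f"
    using assms(2) x_monotone_curve_graph by metis
  then obtain a b f where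
    graph: "\<And>i. i \<in> I \<Longrightarrow> a i \<le> b i \<and> continuous_on {a i..b i} (f i) \<and> C i = graph_over (a i) (b i) (f i)"
    by metis
  \<comment> \<open>For disjoint projections this holds vacuously in both directions, and by itself
    it is not transitive. Combining it with a relation between the projections restores
    transitivity.\<close>
  define below where
    "below i j \<longleftrightarrow> (\<forall>x\<in>{a i..b i} \<inter> {a j..b j}. f i x < f j x)" for i j
  define nested where "nested i j \<longleftrightarrow> a j \<le> a i \<and> b i \<le> b j" for i j
  define shifted where "shifted i j \<longleftrightarrow> a i \<le> a j \<and> b i \<le> b j" for i j
  \<comment> \<open>Orders 0 and 1 compare shifted projections, 2 and 3 nested ones; odd orders turn
    \<open>below\<close> around. Thus \<open>R 3 j v\<close> says that \<open>j\<close> has the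
    smaller projection and lies above \<open>v\<close>.\<close>
  define R where "R n i j \<longleftrightarrow>
     (if n < 2 then shifted i j else nested i j) \<and> (if even n then below i j else below j i)"
    for n :: nat and i j
  have edge_iff: "{i, j} \<in> ?E \<longleftrightarrow> i \<in> I \<and> j \<in> I \<and> i \<noteq> j \<and> C i \<inter> C j = {}" for i j
    unfolding disjointness_edges_def by (auto simp: doubleton_eq_iff)
  \<comment> \<open>The middle curve can mediate at every abscissa where the outer two are compared,
    since its projection covers all of them.\<close>
  have below_trans: "below i l"
    if "{a i..b i} \<inter> {a l..b l} \<subseteq> {a j..b j}" "below i j" "below j l" for i j l
    using that unfolding below_def by (meson IntD1 IntD2 IntI order_less_trans subsetD)
  have below_edge: "{i, j} \<in> ?E" if "i \<in> I" "j \<in> I" "below i j" for i j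
  proof -
    have "C i \<inter> C j = {}"
      using that graph[of i] graph[of j] by (auto simp: graph_over_disjoint_iff below_def)
    \<comment> \<open>Since \<open>a i \<le> b i\<close>, the projection is nonempty, so
      \<open>below i i\<close> fails at the point \<open>a i\<close>.\<close>
    moreover have "i \<noteq> j" using that graph[of i] by (force simp: below_def)
    ultimately show ?thesis using that edge_iff by blast
  qed
  have edge_below: "below i j \<or> below j i" if "{i, j} \<in> ?E" for i j
  proof -
    have ij: "i \<in> I" "j \<in> I" "C i \<inter> C j = {}" using that edge_iff by auto
    let ?S = "{a i..b i} \<inter> {a j..b j}"
    have "(\<forall>x\<in>?S. f i x < f j x) \<or> (\<forall>x\<in>?S. f j x < f i x)"
    proof (rule continuous_never_equal)
      show "continuous_on ?S (f i)" "continuous_on ?S (f j)"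
        using graph[OF ij(1)] graph[OF ij(2)] by (auto intro: continuous_on_subset)
      show "connected ?S" by (simp add: Int_atLeastAtMost)
      show "\<forall>x\<in>?S. f i x \<noteq> f j x"
        using ij(3) graph[OF ij(1)] graph[OF ij(2)] by (simp add: graph_over_disjoint_iff)
    qed
    then show ?thesis unfolding below_def by auto
  qed
  have "2 * chromatic_number I ?E \<le> k ^ 3 * (k + 1)"
    unfolding assms(3)[symmetric]
  proof (rule chromatic_number_le_four_orders[where R = R])
    show "finite I" by fact
    show "{i} \<notin> ?E" for i using edge_iff[of i i] by simp
    show "{i, j} \<in> ?E" if "i \<in> I" "j \<in> I" "R n i j" for n i j
      using that below_edge[of i j] below_edge[of j i]
      by (auto simp: R_def insert_commute split: if_splits)
    show "R n i l" if "R n i j" "R n j l" for n i j l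
    proof -
      \<comment> \<open>For shifted intervals the common part of the outer two is contained in
        \<open>{a l..b i}\<close>, for nested ones in \<open>{a i..b i}\<close>; both lie inside the
        middle interval.\<close>
      have "{a i..b i} \<inter> {a l..b l} \<subseteq> {a j..b j}"
        using that by (auto simp: R_def shifted_def nested_def split: if_splits)
      then have "below i j \<Longrightarrow> below j l \<Longrightarrow> below i l" "below l j \<Longrightarrow> below j i \<Longrightarrow> below l i"
        using below_trans by (metis, metis Int_commute)
      moreover have "shifted i j \<Longrightarrow> shifted j l \<Longrightarrow> shifted i l"
        and "nested i j \<Longrightarrow> nested j l \<Longrightarrow> nested i l"
        by (auto simp: shifted_def nested_def)
      ultimately show ?thesis using that by (auto simp: R_def split: if_splits)
    qed
    show "\<exists>n<4. R n i j \<or> R n j i" if "{i, j} \<in> ?E" for i j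
    proof -
      have R: "R 0 = (\<lambda>i j. shifted i j \<and> below i j)" "R 1 = (\<lambda>i j. shifted i j \<and> below j i)"
        "R 2 = (\<lambda>i j. nested i j \<and> below i j)" "R 3 = (\<lambda>i j. nested i j \<and> below j i)"
        by (auto simp: R_def fun_eq_iff)
      \<comment> \<open>Comparing left and right endpoints: if both comparisons point the same way
        the intervals are shifted, otherwise nested.\<close>
      have "shifted i j \<or> shifted j i \<or> nested i j \<or> nested j i"
        by (auto simp: shifted_def nested_def)
      then have "\<exists>n\<in>{0, 1, 2, 3}. R n i j \<or> R n j i"
        using edge_below[OF that] by (auto simp: R simp del: One_nat_def)
      then show ?thesis by force
    qed
    show "{i, j} \<in> ?E" if "i \<in> I" "j \<in> I" "R 2 i v" "R 3 j v" for i j v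
    proof (rule below_edge)
      \<comment> \<open>Here \<open>v\<close> separates: \<open>i\<close> lies below it and
        \<open>j\<close> above it, and its projection contains both of theirs.\<close>
      show "below i j"
        using that(3,4) by (intro below_trans[of i j v]) (auto simp: R_def nested_def)
    qed fact+
  qed
  then have "real (2 * chromatic_number I ?E) \<le> real (k ^ 3 * (k + 1))"
    by (simp only: of_nat_le_iff)
  then show ?thesis by (simp add: algebra_simps)
qed

end
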